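(* Let $P,a,b,\mathcal{X},\mathcal{U},F,x_{\mathrm{opt}}$ be as described in the context, with all standing assumptions there. Consider the pseudo-gradient dynamics $$\dot x(t)=\Pi_{\mathcal{X}}\big(x(t),-F(x(t))+u(t)\big).$$ Let $u_{\mathrm{opt}}\in\mathcal{U}$ be such that $\mathrm{SOL}(\mathcal{X},F-u_{\mathrm{opt}})=x_{\mathrm{opt}}$. Then, for any initial condition $x(0)\in\mathcal{X}$, the static open-loop intervention $u(t)\equiv u_{\mathrm{opt}}$ steers the action profile $x(t)$ to the social optimum $x_{\mathrm{opt}}$, i.e. $\lim_{t\to\infty}x(t)=x_{\mathrm{opt}}$. Moreover, $u_{\mathrm{opt}}$ satisfies $$u_{\mathrm{opt}}=(I-aP)x_{\mathrm{opt}}-b+v$$ for some $v\in\mathcal{N}_{\mathcal{X}}(x_{\mathrm{opt}})$.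
   Context: Setting. $\mathcal{I}=\{1,\dots,n\}$; $P\in\mathbb{R}^{n\times n}$ with $P_{ij}\in[0,1]$ and $P_{ii}=0$; $a\in\mathbb{R}\setminus\{0\}$; $b\in\mathbb{R}^n$; $\mathcal{X}=\prod_{i\in\mathcal{I}}\mathcal{X}_i$ with $\mathcal{X}_i\subseteq\mathbb{R}$; $\mathcal{U}\subseteq\mathbb{R}^n$ (the intervention set). Notation. $\mathcal{N}_{\mathcal{X}}(x)=\{y\in\mathbb{R}^n: y^\top(s-x)\le 0\ \ \forall s\in\mathcal{X}\}$ is the normal cone at $x\in\mathcal{X}$; $\mathcal{T}_{\mathcal{X}}(x)=\mathrm{cl}\big(\bigcup_{y\in\mathcal{X}}\bigcup_{\lambda>0}\lambda(y-x)\big)$ is the tangent cone; $\Pi_{\mathcal{X}}(x,z)$ is the Euclidean projection of $z$ onto $\mathcal{T}_{\mathcal{X}}(x)$. For a map $G:\mathcal{X}\to\mathbb{R}^n$, $\mathrm{SOL}(\mathcal{X},G)$ is the set of $\bar x\in\mathcal{X}$ with $(x-\bar x)^\top G(\bar x)\ge 0$ for all $x\in\mathcal{X}$; when it is a singleton it is identified with its element. Solutions of the differential equation are Carathéodory: absolutely continuous maps $x:[0,\infty)\to\mathcal{X}$ satisfying the equation for almost all $t\ge 0$. Maps. $F(x)=(I-aP)x-b$ and $H(x)=\big(I-a(P+P^\top)\big)x-b$. Standing assumptions. (1) Each $\mathcal{X}_i$ and $\mathcal{U}$ are nonempty, closed and convex, and $\bm{0}\in\mathcal{U}$. (2) $\max_{i\in\mathcal{I}}a\,\lambda_i(P+P^\top)<1$,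 where $\lambda_i(\cdot)$ are the eigenvalues. Under (1),(2) the social optimum $x_{\mathrm{opt}}$ is defined as the unique element of $\mathrm{SOL}(\mathcal{X},H)$; equivalently it is the unique maximizer over $\mathcal{X}$ of $\sum_{i}\big(-\tfrac12x_i^2+x_i(a\sum_jP_{ij}x_j+b_i)\big)$. (3) $x_{\mathrm{opt}}\in\mathcal{S}:=\{\bar x\in\mathcal{X}:\exists\,\bar u\in\mathcal{U}\text{ such that }\bar x=\mathrm{SOL}(\mathcal{X},F-\bar u)\}$. *)

theory Defs
  imports "HOL-Analysis.Analysis"
begin

section \<open>Eigenvalues of a real square matrix\<close>

definition eigenvalues :: "real^'n^'n \<Rightarrow> real set"
  where "eigenvalues A = {l. \<exists>v. v \<noteq> 0 \<and> A *v v = l *\<^sub>R v}"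

text \<open>
  For symmetric matrices all complex eigenvalues are real. The two lemmas below show that
  \<open>Max\<close> over the (real) eigenvalues of a symmetric matrix is well defined.
\<close>

lemma finite_eigenvalues:
  fixes A :: "real^'n^'n"
  assumes "transpose A = A"
  shows "finite (eigenvalues A)"
proof -
  have "\<forall>l. \<exists>v. l \<in> eigenvalues A \<longrightarrow> v \<noteq> 0 \<and> A *v v = l *\<^sub>R v"
    by (auto simp: eigenvalues_def)
  then obtain v where v: "\<And>l. l \<in> eigenvalues A \<Longrightarrow> v l \<noteq> 0 \<and> A *v v l = l *\<^sub>R v l"
    by metis
  have sym: "x \<bullet> (A *v y) = (A *v x) \<bullet> y" for x y
    using dot_lmul_matrix[of x A y] assms by (metis vector_transpose_matrix)
  have orth: "v l \<bullet> v m = 0" if "l \<in> eigenvalues A" "m \<in> eigenvalues A" "l \<noteq> m" for l m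
  proof -
    have "m * (v l \<bullet> v m) = l * (v l \<bullet> v m)"
      using sym[of "v l" "v m"] v that by simp
    then show ?thesis using that by simp
  qed
  have inj: "inj_on v (eigenvalues A)"
    by (rule inj_onI) (metis orth v inner_eq_zero_iff)
  have "pairwise orthogonal (v ` eigenvalues A)"
    by (auto simp: pairwise_def orthogonal_def intro!: orth)
  then have "independent (v ` eigenvalues A)"
    using v by (intro pairwise_orthogonal_independent) force+
  then show ?thesis
    using inj finite_imageD independent_imp_finite by blast
qed

lemma eigenvalues_nonempty:
  fixes A :: "real^'n^'n"
  assumes "transpose A = A"
  shows "eigenvalues A \<noteq> {}"
proof -
  define q where "q x = x \<bullet> (A *v x)" for x :: "real^'n"
  have sym: "x \<bullet> (A *v y) = (A *v x) \<bullet> y" for x y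
    using dot_lmul_matrix[of x A y] assms by (metis vector_transpose_matrix)
  have "continuous_on (sphere 0 1) q"
    unfolding q_def by (intro continuous_intros linear_continuous_on matrix_vector_mul_bounded_linear)
  moreover have "axis undefined 1 \<in> sphere (0::real^'n) 1"
    by simp
  ultimately obtain v where v: "norm v = 1" and max: "\<And>x. norm x = 1 \<Longrightarrow> q x \<le> q v"
    using continuous_attains_sup[of "sphere (0::real^'n) 1" q] by (auto simp: compact_sphere)
  have q_scale: "q (c *\<^sub>R x) = c\<^sup>2 * q x" for c x
    by (simp add: q_def matrix_vector_mult_scaleR power2_eq_square)
  have q_le: "q x \<le> q v * (norm x)\<^sup>2" for x
  proof (cases "x = 0")
    case False
    then have "q (x /\<^sub>R norm x) \<le> q v" by (intro max) simp
    moreover have "q x = (norm x)\<^sup>2 * q (x /\<^sub>R norm x)"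
      using False q_scale[of "norm x" "x /\<^sub>R norm x"] by simp
    ultimately show ?thesis
      by (metis mult.commute mult_left_mono zero_le_power2)
  qed (simp add: q_def)
  define w where "w = q v *\<^sub>R v - A *v v"
  define R where "R = q v * (norm w)\<^sup>2 - q w"
  have nonneg: "0 \<le> 2 * t * (w \<bullet> w) + t\<^sup>2 * R" for t
  proof -
    have "q (v + t *\<^sub>R w) = q v + 2 * t * (w \<bullet> (A *v v)) + t\<^sup>2 * q w"
      using sym[of v w]
      by (simp add: q_def matrix_vector_right_distrib matrix_vector_mult_scaleR inner_add_left
          inner_add_right power2_eq_square inner_commute algebra_simps)
    moreover have "(norm (v + t *\<^sub>R w))\<^sup>2 = 1 + 2 * t * (w \<bullet> v) + t\<^sup>2 * (norm w)\<^sup>2"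
      using v unfolding power2_norm_eq_inner norm_eq_1
      by (simp add: inner_add_left inner_add_right power2_eq_square inner_commute algebra_simps)
    moreover have "w \<bullet> (A *v v) = q v * (w \<bullet> v) - w \<bullet> w"
      by (simp add: w_def inner_diff_right)
    ultimately show ?thesis
      using q_le[of "v + t *\<^sub>R w"] by (simp add: R_def algebra_simps)
  qed
  have "w \<bullet> w = 0"
  proof (rule ccontr)
    assume "w \<bullet> w \<noteq> 0"
    then have pos: "0 < w \<bullet> w" by simp
    define t where "t = - (w \<bullet> w) / (\<bar>R\<bar> + 1)"
    have "t < 0" using pos by (simp add: t_def divide_neg_pos)
    have "0 \<le> t * (2 * (w \<bullet> w) + t * R)"
      using nonneg[of t] by (simp add: power2_eq_square algebra_simps)
    then have "2 * (w \<bullet> w) + t * R \<le> 0"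
      using \<open>t < 0\<close> by (simp add: zero_le_mult_iff)
    moreover have "\<bar>t * R\<bar> \<le> w \<bullet> w"
    proof -
      have "\<bar>t\<bar> * (\<bar>R\<bar> + 1) = w \<bullet> w"
        by (simp add: t_def abs_divide)
      then show ?thesis
        by (simp add: abs_mult algebra_simps)
    qed
    ultimately show False using pos by linarith
  qed
  then have "A *v v = q v *\<^sub>R v" by (simp add: w_def)
  moreover have "v \<noteq> 0" using v by auto
  ultimately show ?thesis by (auto simp: eigenvalues_def)
qed

section \<open>Cones, projection, variational inequalities\<close>

definition normal_cone :: "(real^'n) set \<Rightarrow> real^'n \<Rightarrow> (real^'n) set"
  where "normal_cone X x = {y. \<forall>s\<in>X. y \<bullet> (s - x) \<le> 0}"

definition tangent_cone :: "(real^'n) set \<Rightarrow> real^'n \<Rightarrow> (real^'n) set"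
  where "tangent_cone X x = closure (\<Union>y\<in>X. \<Union>l\<in>{0<..}. {l *\<^sub>R (y - x)})"

definition proj_tangent :: "(real^'n) set \<Rightarrow> real^'n \<Rightarrow> real^'n \<Rightarrow> real^'n"
  where "proj_tangent X x z = closest_point (tangent_cone X x) z"

definition SOL :: "(real^'n) set \<Rightarrow> (real^'n \<Rightarrow> real^'n) \<Rightarrow> (real^'n) set"
  where "SOL X G = {xb \<in> X. \<forall>x\<in>X. (x - xb) \<bullet> G xb \<ge> 0}"

section \<open>Caratheodory solutions\<close>

definition absolutely_continuous_on :: "real set \<Rightarrow> (real \<Rightarrow> 'a::real_normed_vector) \<Rightarrow> bool"
  where "absolutely_continuous_on S f \<longleftrightarrow>
    (\<forall>e>0. \<exists>d>0. \<forall>D. D division_of \<Union>D \<and> \<Union>D \<subseteq> S \<and> (\<Sum>K\<in>D. Sup K - Inf K) < d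
        \<longrightarrow> (\<Sum>K\<in>D. norm (f (Sup K) - f (Inf K))) < e)"

text \<open>
  On the unbounded domain \<open>[0, \<infinity>)\<close> absolute continuity is understood as usual for differential
  equations, i.e. on every compact subinterval. The values of \<open>x\<close> at negative times are irrelevant.
\<close>

definition caratheodory_solution ::
    "(real^'n) set \<Rightarrow> (real \<Rightarrow> real^'n \<Rightarrow> real^'n) \<Rightarrow> (real \<Rightarrow> real^'n) \<Rightarrow> bool"
  where "caratheodory_solution X g x \<longleftrightarrow>
    (\<forall>t\<ge>0. x t \<in> X) \<and>
    (\<forall>T\<ge>0. absolutely_continuous_on {0..T} x) \<and>
    (AE t in lebesgue. t \<ge> 0 \<longrightarrow> (x has_vector_derivative g t (x t)) (at t within {0..}))"

section \<open>The network game\<close>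

definition F_map :: "real^'n^'n \<Rightarrow> real \<Rightarrow> real^'n \<Rightarrow> real^'n \<Rightarrow> real^'n"
  where "F_map P a b x = (mat 1 - a *\<^sub>R P) *v x - b"

definition H_map :: "real^'n^'n \<Rightarrow> real \<Rightarrow> real^'n \<Rightarrow> real^'n \<Rightarrow> real^'n"
  where "H_map P a b x = (mat 1 - a *\<^sub>R (P + transpose P)) *v x - b"

definition social_optimum :: "real^'n^'n \<Rightarrow> real \<Rightarrow> real^'n \<Rightarrow> (real^'n) set \<Rightarrow> real^'n"
  where "social_optimum P a b X = the_elem (SOL X (H_map P a b))"

definition achievable_set ::
    "real^'n^'n \<Rightarrow> real \<Rightarrow> real^'n \<Rightarrow> (real^'n) set \<Rightarrow> (real^'n) set \<Rightarrow> (real^'n) set"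
  where "achievable_set P a b X U =
    {xb \<in> X. \<exists>ub\<in>U. SOL X (\<lambda>x. F_map P a b x - ub) = {xb}}"

definition pseudo_gradient_solution ::
    "real^'n^'n \<Rightarrow> real \<Rightarrow> real^'n \<Rightarrow> (real^'n) set \<Rightarrow> (real \<Rightarrow> real^'n) \<Rightarrow> (real \<Rightarrow> real^'n) \<Rightarrow> bool"
  where "pseudo_gradient_solution P a b X u x \<longleftrightarrow>
    caratheodory_solution X (\<lambda>t y. proj_tangent X y (- F_map P a b y + u t)) x"

end

theory Submission
  imports Defs
begin

text \<open>
  The residual \<open>z - \<Pi>(x, z)\<close> of the projection lies in the normal cone at \<open>x\<close>, so the variational
  inequality at \<open>x_opt\<close> and the strong monotonicity of \<open>F\<close> give \<open>V' \<le> - V\<close> almost everywhere for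
  \<open>V(t) = |x(t) - x_opt|\<^sup>2\<close>. Hence \<open>e\<^sup>t V(t)\<close> is absolutely continuous with nonpositive
  derivative almost everywhere, thus nonincreasing, and \<open>V\<close> decays exponentially.
\<close>

section \<open>Absolutely continuous functions\<close>

lemma absolutely_continuous_onE:
  assumes "absolutely_continuous_on S f" "e > 0"
  obtains d where "d > 0"
    "\<And>D. D division_of \<Union>D \<Longrightarrow> \<Union>D \<subseteq> S \<Longrightarrow> (\<Sum>K\<in>D. Sup K - Inf K) < d \<Longrightarrow>
      (\<Sum>K\<in>D. norm (f (Sup K) - f (Inf K))) < e"
proof -
  from assms obtain d where "d > 0"
    "\<forall>D. D division_of \<Union>D \<and> \<Union>D \<subseteq> S \<and> (\<Sum>K\<in>D. Sup K - Inf K) < d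
      \<longrightarrow> (\<Sum>K\<in>D. norm (f (Sup K) - f (Inf K))) < e"
    unfolding absolutely_continuous_on_def by meson
  then show thesis by (intro that[of d]) auto
qed

text \<open>A division with the single cell \<open>{u..v}\<close> already yields uniform continuity.
  Continuity is what later bounds the factors of a product on a compact interval.\<close>

lemma absolutely_continuous_on_imp_continuous_on:
  fixes f :: "real \<Rightarrow> 'a::real_normed_vector"
  assumes ac: "absolutely_continuous_on {a..b} f"
  shows "continuous_on {a..b} f"
  unfolding continuous_on_iff
proof (intro ballI allI impI)
  fix s e :: real
  assume s: "s \<in> {a..b}" and "0 < e"
  then obtain d where "d > 0" and d: "\<And>D. D division_of \<Union>D \<Longrightarrow> \<Union>D \<subseteq> {a..b} \<Longrightarrow>
      (\<Sum>K\<in>D. Sup K - Inf K) < d \<Longrightarrow> (\<Sum>K\<in>D. norm (f (Sup K) - f (Inf K))) < e"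
    using absolutely_continuous_onE[OF ac \<open>0 < e\<close>] by blast
  have close: "norm (f v - f u) < e" if "u \<in> {a..b}" "v \<in> {a..b}" "u \<le> v" "v - u < d" for u v
  proof -
    have "{{u..v}} division_of \<Union>{{u..v}}"
      using division_of_self[of u v] that(3) by simp
    moreover have "\<Union>{{u..v}} \<subseteq> {a..b}" "(\<Sum>K\<in>{{u..v}}. Sup K - Inf K) < d"
      using that by simp_all
    ultimately have "(\<Sum>K\<in>{{u..v}}. norm (f (Sup K) - f (Inf K))) < e"
      by (rule d)
    then show ?thesis
      using that(3) by simp
  qed
  have "dist (f t) (f s) < e" if "t \<in> {a..b}" "dist t s < d" for t
    using close[of s t] close[of t s] s that
    by (cases "s \<le> t") (auto simp: dist_norm norm_minus_commute[of "f s"])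
  with \<open>d > 0\<close> show "\<exists>d>0. \<forall>t\<in>{a..b}. dist t s < d \<longrightarrow> dist (f t) (f s) < e"
    by blast
qed

text \<open>
  Sum a Cousin-fine tagged division: at tags outside the null set the derivative controls the
  increments, and the intervals tagged inside it lie in a small open set, where absolute
  continuity applies.
\<close>
lemma absolutely_continuous_on_deriv_nonpos:
  fixes f :: "real \<Rightarrow> real"
  assumes ac: "absolutely_continuous_on {a..b} f" and ab: "a \<le> b"
    and N: "N \<in> null_sets lebesgue"
    and deriv: "\<And>t. t \<in> {a..b} - N \<Longrightarrow> \<exists>D\<le>0. (f has_real_derivative D) (at t within {a..b})"
  shows "f b \<le> f a"
proof -
  \<comment> \<open>The summand \<open>1\<close> pays for the cells tagged in \<open>N\<close>, the
    summand \<open>b - a\<close> for all other cells.\<close>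
  have bound: "f b - f a \<le> e * (1 + (b - a))" if e: "e > 0" for e
  proof -
    obtain d where "d > 0" and d: "\<And>D. D division_of \<Union>D \<Longrightarrow> \<Union>D \<subseteq> {a..b} \<Longrightarrow>
      (\<Sum>K\<in>D. Sup K - Inf K) < d \<Longrightarrow> (\<Sum>K\<in>D. norm (f (Sup K) - f (Inf K))) < e"
      using absolutely_continuous_onE[OF ac e] by blast
    obtain G where G: "open G" "N \<subseteq> G" "G - N \<in> lmeasurable" "emeasure lebesgue (G - N) < ennreal d"
      using sets_lebesgue_outer_open[OF null_setsD2[OF N] \<open>d > 0\<close>] by metis
    have N_meas: "N \<in> lmeasurable" "measure lebesgue N = 0"
      using N by (auto simp: fmeasurable_def null_sets_def measure_def)
    have G_eq: "G = (G - N) \<union> N"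
      using G(2) by blast
    have G_meas: "G \<in> lmeasurable"
      using G(3) N_meas(1) G_eq fmeasurable.Un by metis
    have "measure lebesgue (G - N) < d"
      using G(3,4) \<open>d > 0\<close> by (simp add: emeasure_eq_measure2 ennreal_less_iff)
    then have G_small: "measure lebesgue G < d"
      using measure_Un_le[of "G - N" lebesgue N] G(3) N_meas G_eq by (auto simp: fmeasurableD)
    \<comment> \<open>These radii form the gauge: balls around tags in \<open>N\<close> stay inside
      \<open>G\<close>, and around the other tags in \<open>{a..b}\<close> the increment over any
      interval straddling the tag is controlled.\<close>
    have "\<exists>r>0. (t \<in> N \<longrightarrow> ball t r \<subseteq> G) \<and>
        (t \<in> {a..b} - N \<longrightarrow> (\<forall>u\<in>{a..b}. \<forall>v\<in>{a..b}. u \<le> t \<and> t \<le> v \<and> u \<in> ball t r \<and> v \<in> ball t r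
          \<longrightarrow> f v - f u \<le> e * (v - u)))" for t
    proof (cases "t \<in> {a..b} - N")
      case True
      then obtain D where "D \<le> 0" and D: "(f has_real_derivative D) (at t within {a..b})"
        using deriv by blast
      then have "\<exists>r>0. \<forall>y\<in>{a..b}. \<bar>y - t\<bar> < r \<longrightarrow> \<bar>f y - f t - D * (y - t)\<bar> \<le> e * \<bar>y - t\<bar>"
        using e unfolding has_field_derivative_def has_derivative_within_alt real_norm_def by blast
      then obtain r where "r > 0" and r: "\<And>y. y \<in> {a..b} \<Longrightarrow> \<bar>y - t\<bar> < r \<Longrightarrow>
          \<bar>f y - f t - D * (y - t)\<bar> \<le> e * \<bar>y - t\<bar>"
        by blast
      have "f v - f u \<le> e * (v - u)"
        if "u \<in> {a..b}" "v \<in> {a..b}" "u \<le> t" "t \<le> v" "u \<in> ball t r" "v \<in> ball t r" for u v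
      proof -
        \<comment> \<open>Because \<open>u\<close> and \<open>v\<close> lie on opposite sides of
          \<open>t\<close>, the two error terms add up to exactly
          \<open>e * (v - u)\<close>.\<close>
        have "f v - f t - D * (v - t) \<le> e * (v - t)" "- (f u - f t - D * (u - t)) \<le> e * (t - u)"
          using r[of u] r[of v] that by (auto simp: dist_real_def)
        moreover have "D * (v - u) \<le> 0"
          using \<open>D \<le> 0\<close> that by (simp add: mult_nonpos_nonneg)
        ultimately show ?thesis
          by (simp add: algebra_simps)
      qed
      with True \<open>r > 0\<close> show ?thesis by blast
    next
      case False
      show ?thesis
      proof (cases "t \<in> N")
        case True
        then show ?thesis
          using G(1,2) False open_contains_ball[of G] by blast
      qed (use False in \<open>auto intro: exI[of _ 1]\<close>)
    qed
    then obtain r where r0: "\<And>t. r t > 0" and rN: "\<And>t. t \<in> N \<Longrightarrow> ball t (r t) \<subseteq> G"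
      and rD: "\<And>t u v. t \<in> {a..b} - N \<Longrightarrow> u \<in> {a..b} \<Longrightarrow> v \<in> {a..b} \<Longrightarrow> u \<le> t \<Longrightarrow> t \<le> v \<Longrightarrow>
        u \<in> ball t (r t) \<Longrightarrow> v \<in> ball t (r t) \<Longrightarrow> f v - f u \<le> e * (v - u)"
      by metis
    obtain p where p: "p tagged_division_of {a..b}" and fine: "(\<lambda>t. ball t (r t)) fine p"
      using fine_division_exists_real[OF gauge_ball_dependent[of r]] r0 by blast
    have fin: "finite p"
      using p by auto
    have interval: "\<exists>u v. K = {u..v} \<and> Inf K = u \<and> Sup K = v \<and> u \<le> t \<and> t \<le> v
        \<and> u \<in> {a..b} \<and> v \<in> {a..b} \<and> K \<subseteq> ball t (r t)" if tK: "(t, K) \<in> p" for t K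
    proof -
      obtain u v where "K = {u..v}"
        using tagged_division_ofD(4)[OF p tK] by auto
      moreover have "t \<in> K" "K \<subseteq> {a..b}" "K \<subseteq> ball t (r t)"
        using tagged_division_ofD(2,3)[OF p tK] fineD[OF fine tK] by auto
      ultimately show ?thesis
        by (intro exI[of _ u] exI[of _ v]) auto
    qed
    define q where "q = {tK \<in> p. fst tK \<in> N}"
    define D where "D = snd ` q"
    have q_part: "q tagged_partial_division_of {a..b}"
      by (rule tagged_partial_division_subset[of p]) (use p q_def in \<open>auto simp: tagged_division_of_def\<close>)
    have D_div: "D division_of \<Union>D"
      unfolding D_def by (rule partial_division_of_tagged_division[OF q_part])
    have D_interval: "\<exists>t\<in>N. \<exists>u v. K = {u..v} \<and> u \<le> v \<and> K \<subseteq> {a..b} \<and> K \<subseteq> ball t (r t)"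
      if "K \<in> D" for K
    proof -
      from that obtain t where "(t, K) \<in> p" "t \<in> N"
        by (auto simp: D_def q_def)
      with interval[of t K] show ?thesis by fastforce
    qed
    have "\<Union>D \<subseteq> {a..b}"
      using D_interval by blast
    moreover have "(\<Sum>K\<in>D. Sup K - Inf K) < d"
    proof -
      \<comment> \<open>Total length becomes a measure here: the cells of a division overlap only in
        null sets, so their union, contained in \<open>G\<close>, has this measure.\<close>
      have "(\<Sum>K\<in>D. Sup K - Inf K) = (\<Sum>K\<in>D. measure lebesgue K)"
        using D_interval by (intro sum.cong) force+
      also have "\<dots> = measure lebesgue (\<Union>D)"
        by (rule content_division[OF D_div])
      also have "\<dots> \<le> measure lebesgue G"
      proof (rule measure_mono_fmeasurable)
        show "\<Union>D \<subseteq> G" using D_interval rN by blast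
        show "\<Union>D \<in> sets lebesgue"
          using lmeasurable_division[OF D_div] by (simp add: fmeasurableD)
      qed (rule G_meas)
      finally show ?thesis using G_small by simp
    qed
    ultimately have small: "(\<Sum>K\<in>D. norm (f (Sup K) - f (Inf K))) < e"
      using d D_div by blast
    \<comment> \<open>Passing from tagged pairs to cells requires a summand that vanishes on every
      box with empty interior. This includes the empty box, where \<open>Sup\<close> and
      \<open>Inf\<close> have no useful value, hence the explicit \<open>0\<close>.\<close>
    let ?g = "\<lambda>K. if K = {} then 0 else norm (f (Sup K) - f (Inf K))"
    have "(\<Sum>(t, K)\<in>q. f (Sup K) - f (Inf K)) \<le> (\<Sum>(t, K)\<in>q. ?g K)"
      by (rule sum_mono) (use interval q_def in fastforce)
    also have "\<dots> = (\<Sum>K\<in>D. ?g K)"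
      unfolding D_def
    proof (rule sum.over_tagged_division_lemma[OF tagged_partial_division_of_Union_self[OF q_part]])
      show "?g (cbox u v) = 0" if "box u v = {}" for u v :: real
        using that by (cases "u = v") auto
    qed
    also have "\<dots> = (\<Sum>K\<in>D. norm (f (Sup K) - f (Inf K)))"
      using D_interval by (intro sum.cong) fastforce+
    finally have in_N: "(\<Sum>(t, K)\<in>q. f (Sup K) - f (Inf K)) \<le> e"
      using small by simp
    have "(\<Sum>(t, K)\<in>p - q. f (Sup K) - f (Inf K)) \<le> (\<Sum>(t, K)\<in>p - q. e * (Sup K - Inf K))"
    proof (rule sum_mono, clarify)
      fix t K assume tK: "(t, K) \<in> p" "(t, K) \<notin> q"
      then have "t \<notin> N" by (auto simp: q_def)
      obtain u v where "K = {u..v}" "Inf K = u" "Sup K = v" "u \<le> t" "t \<le> v"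
          "u \<in> {a..b}" "v \<in> {a..b}" "K \<subseteq> ball t (r t)"
        using interval[OF tK(1)] by blast
      then show "f (Sup K) - f (Inf K) \<le> e * (Sup K - Inf K)"
        using rD[of t u v] \<open>t \<notin> N\<close> by (auto simp: subset_iff)
    qed
    \<comment> \<open>The omitted terms are nonnegative; over all of \<open>p\<close> the lengths
      telescope to \<open>b - a\<close>.\<close>
    also have "\<dots> \<le> (\<Sum>(t, K)\<in>p. e * (Sup K - Inf K))"
    proof (rule sum_mono2[OF fin])
      show "0 \<le> (case tK of (t, K) \<Rightarrow> e * (Sup K - Inf K))" if "tK \<in> p - (p - q)" for tK
        using interval[of "fst tK" "snd tK"] that e by (auto split: prod.split)
    qed auto
    also have "\<dots> = e * (\<Sum>(t, K)\<in>p. Sup K - Inf K)"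
      by (simp add: sum_distrib_left case_prod_unfold)
    also have "\<dots> = e * (b - a)"
      using additive_tagged_division_1[OF ab p, of "\<lambda>t. t"] by simp
    finally have "(\<Sum>(t, K)\<in>p - q. f (Sup K) - f (Inf K)) \<le> e * (b - a)" .
    moreover have "f b - f a = (\<Sum>(t, K)\<in>p - q. f (Sup K) - f (Inf K)) + (\<Sum>(t, K)\<in>q. f (Sup K) - f (Inf K))"
      unfolding additive_tagged_division_1[OF ab p, of f, symmetric]
      by (rule sum.subset_diff) (auto simp: q_def fin)
    ultimately show ?thesis
      using in_N by (simp add: algebra_simps)
  qed
  have "f b - f a \<le> 0 + e" if "e > 0" for e
  proof -
    have "1 + (b - a) > 0" using ab by simp
    then show ?thesis
      using bound[of "e / (1 + (b - a))"] that by simp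
  qed
  then have "f b - f a \<le> 0"
    by (rule field_le_epsilon)
  then show ?thesis by simp
qed

text \<open>Closure properties of absolute continuity reduce to one estimate on increments, which is
  then summed over a division. Two dominating functions suit products; with only one, it is supplied
  twice.\<close>

lemma absolutely_continuous_on_dominated:
  fixes f :: "real \<Rightarrow> 'a::real_normed_vector" and g :: "real \<Rightarrow> 'b::real_normed_vector"
    and h :: "real \<Rightarrow> 'c::real_normed_vector"
  assumes f: "absolutely_continuous_on S f" and g: "absolutely_continuous_on S g"
    and C: "\<And>u v. u \<in> S \<Longrightarrow> v \<in> S \<Longrightarrow> norm (h v - h u) \<le> C * (norm (f v - f u) + norm (g v - g u))"
  shows "absolutely_continuous_on S h"
  unfolding absolutely_continuous_on_def
proof (intro allI impI)
  fix e :: real assume "e > 0"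
  \<comment> \<open>The sign of \<open>C\<close> is arbitrary; a positive majorant makes
    \<open>e / (2 * B)\<close> a legitimate tolerance.\<close>
  define B where "B = \<bar>C\<bar> + 1"
  have "B > 0" "C \<le> B" by (auto simp: B_def)
  define e' where "e' = e / (2 * B)"
  have "e' > 0" using \<open>e > 0\<close> \<open>B > 0\<close> by (simp add: e'_def)
  obtain d1 where "d1 > 0" and d1: "\<And>D. D division_of \<Union>D \<Longrightarrow> \<Union>D \<subseteq> S \<Longrightarrow>
      (\<Sum>K\<in>D. Sup K - Inf K) < d1 \<Longrightarrow> (\<Sum>K\<in>D. norm (f (Sup K) - f (Inf K))) < e'"
    using absolutely_continuous_onE[OF f \<open>e' > 0\<close>] by blast
  obtain d2 where "d2 > 0" and d2: "\<And>D. D division_of \<Union>D \<Longrightarrow> \<Union>D \<subseteq> S \<Longrightarrow>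
      (\<Sum>K\<in>D. Sup K - Inf K) < d2 \<Longrightarrow> (\<Sum>K\<in>D. norm (g (Sup K) - g (Inf K))) < e'"
    using absolutely_continuous_onE[OF g \<open>e' > 0\<close>] by blast
  have "(\<Sum>K\<in>D. norm (h (Sup K) - h (Inf K))) < e"
    if D: "D division_of \<Union>D" "\<Union>D \<subseteq> S" "(\<Sum>K\<in>D. Sup K - Inf K) < min d1 d2" for D
  proof -
    let ?f = "\<lambda>K. norm (f (Sup K) - f (Inf K))" and ?g = "\<lambda>K. norm (g (Sup K) - g (Inf K))"
    have "(\<Sum>K\<in>D. norm (h (Sup K) - h (Inf K))) \<le> (\<Sum>K\<in>D. B * (?f K + ?g K))"
    proof (rule sum_mono)
      fix K assume K: "K \<in> D"
      then obtain u v where "K = cbox u v" "K \<noteq> {}"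
        using division_ofD(3,4)[OF D(1)] by metis
      then have "Sup K \<in> S" "Inf K \<in> S"
        using K D(2) by (auto intro!: subsetD[OF D(2)] UnionI[OF K])
      then have "norm (h (Sup K) - h (Inf K)) \<le> C * (?f K + ?g K)"
        by (rule C[rotated])
      also have "\<dots> \<le> B * (?f K + ?g K)"
        using \<open>C \<le> B\<close> by (intro mult_right_mono) auto
      finally show "norm (h (Sup K) - h (Inf K)) \<le> B * (?f K + ?g K)" .
    qed
    also have "\<dots> = B * (sum ?f D + sum ?g D)"
      by (simp only: sum_distrib_left[symmetric] sum.distrib)
    also have "\<dots> < B * (e' + e')"
      using d1[of D] d2[of D] D \<open>B > 0\<close> by (intro mult_strict_left_mono add_strict_mono) auto
    also have "\<dots> = e"
      using \<open>B > 0\<close> by (simp add: e'_def field_simps)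
    finally show ?thesis .
  qed
  then show "\<exists>d>0. \<forall>D. D division_of \<Union>D \<and> \<Union>D \<subseteq> S \<and> (\<Sum>K\<in>D. Sup K - Inf K) < d
        \<longrightarrow> (\<Sum>K\<in>D. norm (h (Sup K) - h (Inf K))) < e"
    using \<open>d1 > 0\<close> \<open>d2 > 0\<close> by (intro exI[of _ "min d1 d2"]) auto
qed

text \<open>Increments are dominated by those of the identity, for which \<open>d = e\<close> works
  since both sums are the total length. This serves the exponential weight.\<close>

lemma lipschitz_imp_absolutely_continuous_on:
  fixes f :: "real \<Rightarrow> 'a::real_normed_vector"
  assumes "C-lipschitz_on S f"
  shows "absolutely_continuous_on S f"
proof (rule absolutely_continuous_on_dominated)
  have id: "absolutely_continuous_on S (\<lambda>t. t :: real)"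
    unfolding absolutely_continuous_on_def
  proof (intro allI impI)
    fix e :: real assume "e > 0"
    moreover have "(\<Sum>K\<in>D. norm (Sup K - Inf K)) = (\<Sum>K\<in>D. Sup K - Inf K)"
      if D: "D division_of \<Union>D" for D :: "real set set"
    proof (rule sum.cong)
      fix K assume "K \<in> D"
      then obtain u v where "K = cbox u v" "K \<noteq> {}"
        using division_ofD(3,4)[OF D] by metis
      then show "norm (Sup K - Inf K) = Sup K - Inf K" by auto
    qed simp
    ultimately show "\<exists>d>0. \<forall>D. D division_of \<Union>D \<and> \<Union>D \<subseteq> S \<and> (\<Sum>K\<in>D. Sup K - Inf K) < d
        \<longrightarrow> (\<Sum>K\<in>D. norm (Sup K - Inf K)) < e"
      by (intro exI[of _ e]) auto
  qed
  show "absolutely_continuous_on S (\<lambda>t. t :: real)" "absolutely_continuous_on S (\<lambda>t. t :: real)"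
    by (rule id)+
  show "norm (f v - f u) \<le> C * (norm (v - u) + norm (v - u))" if "u \<in> S" "v \<in> S" for u v
  proof -
    have "norm (f v - f u) \<le> C * norm (v - u)"
      using lipschitz_onD[OF assms that(2,1)] by (simp add: dist_norm)
    also have "\<dots> \<le> C * (norm (v - u) + norm (v - u))"
      using lipschitz_on_nonneg[OF assms] by (intro mult_left_mono) auto
    finally show ?thesis .
  qed
qed

text \<open>The increment of a product splits into one term per factor, and the other factor is
  bounded by compactness. The bilinear form covers both the inner product and real
  multiplication.\<close>

lemma (in bounded_bilinear) absolutely_continuous_on:
  assumes f: "absolutely_continuous_on {s..t} f" and g: "absolutely_continuous_on {s..t} g"
  shows "absolutely_continuous_on {s..t} (\<lambda>r. prod (f r) (g r))"
proof -
  obtain K where "K > 0" and K: "\<And>x y. norm (prod x y) \<le> norm x * norm y * K"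
    using pos_bounded by blast
  have "\<exists>B>0. \<forall>r\<in>{s..t}. norm (h r) \<le> B"
    if "absolutely_continuous_on {s..t} h" for h :: "real \<Rightarrow> 'z::real_normed_vector"
    using compact_imp_bounded[OF compact_continuous_image
        [OF absolutely_continuous_on_imp_continuous_on[OF that] compact_Icc]]
    by (auto simp: bounded_pos)
  from this[OF f] this[OF g] obtain Bf Bg where B: "Bf > 0" "Bg > 0"
    and Bf: "\<And>r. r \<in> {s..t} \<Longrightarrow> norm (f r) \<le> Bf" and Bg: "\<And>r. r \<in> {s..t} \<Longrightarrow> norm (g r) \<le> Bg"
    by blast
  show ?thesis
  proof (rule absolutely_continuous_on_dominated[OF f g])
    fix u v assume uv: "u \<in> {s..t}" "v \<in> {s..t}"
    have "prod (f v) (g v) - prod (f u) (g u) = prod (f v - f u) (g v) + prod (f u) (g v - g u)"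
      by (simp add: diff_left diff_right)
    also have "norm \<dots> \<le> norm (f v - f u) * norm (g v) * K + norm (f u) * norm (g v - g u) * K"
      by (intro norm_triangle_mono K)
    \<comment> \<open>Both bounds are enlarged to \<open>Bf + Bg\<close> so that a single constant
      factors out.\<close>
    also have "\<dots> \<le> norm (f v - f u) * (Bf + Bg) * K + (Bf + Bg) * norm (g v - g u) * K"
      using Bf[OF uv(1)] Bg[OF uv(2)] B \<open>K > 0\<close>
      by (intro add_mono mult_right_mono mult_left_mono) auto
    also have "\<dots> = ((Bf + Bg) * K) * (norm (f v - f u) + norm (g v - g u))"
      by (simp add: algebra_simps)
    finally show "norm (prod (f v) (g v) - prod (f u) (g u))
        \<le> ((Bf + Bg) * K) * (norm (f v - f u) + norm (g v - g u))" .
  qed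
qed

section \<open>Quadratic forms of symmetric matrices\<close>

lemma symmetric_matrix_inner:
  fixes A :: "real^'n^'n"
  assumes "transpose A = A"
  shows "x \<bullet> (A *v y) = (A *v x) \<bullet> y"
  using dot_lmul_matrix[of x A y] assms by (metis vector_transpose_matrix)

text \<open>Such a \<open>v\<close> minimizes the quadratic form. Moving from \<open>v\<close>
  against \<open>M *v v\<close> changes the form to first order by a negative multiple of
  \<open>w \<bullet> w\<close>, which contradicts semidefiniteness unless
  \<open>w = 0\<close>.\<close>

lemma psd_matrix_vector_eq_0:
  fixes M :: "real^'n^'n"
  assumes sym: "transpose M = M" and psd: "\<And>x. 0 \<le> x \<bullet> (M *v x)" and v: "v \<bullet> (M *v v) = 0"
  shows "M *v v = 0"
proof -
  define w where "w = M *v v"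
  have "2 * (w \<bullet> w) \<le> 0 + e" if "e > 0" for e
  proof -
    \<comment> \<open>The added \<open>1\<close> keeps the denominator positive when the form
      vanishes at \<open>w\<close>, and the quadratic correction stays below
      \<open>e\<close>.\<close>
    define t where "t = e / (w \<bullet> (M *v w) + 1)"
    have t: "t > 0" "t * (w \<bullet> (M *v w)) \<le> e"
      using psd[of w] that by (auto simp: t_def field_simps add_nonneg_pos)
    have "(v - t *\<^sub>R w) \<bullet> (M *v (v - t *\<^sub>R w)) = t * (t * (w \<bullet> (M *v w)) - 2 * (w \<bullet> w))"
      using symmetric_matrix_inner[OF sym, of v w] v
      by (simp add: w_def matrix_vector_mult_diff_distrib matrix_vector_mult_scaleR
          inner_diff_left inner_diff_right inner_commute algebra_simps)
    then have "0 \<le> t * (w \<bullet> (M *v w)) - 2 * (w \<bullet> w)"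
      using psd[of "v - t *\<^sub>R w"] t(1) by (simp add: zero_le_mult_iff)
    then show ?thesis using t(2) by simp
  qed
  then have "2 * (w \<bullet> w) \<le> 0"
    by (rule field_le_epsilon)
  then have "w \<bullet> w = 0"
    using inner_ge_zero[of w] by linarith
  then show ?thesis by (simp add: w_def)
qed

text \<open>The maximum \<open>l\<close> of the form on the unit sphere makes
  \<open>l *\<^sub>R mat 1 - A\<close> positive semidefinite with form zero at the maximizer, which
  is therefore an eigenvector. This turns the eigenvalue hypothesis into a bound on the quadratic
  form.\<close>

lemma symmetric_matrix_rayleigh:
  fixes A :: "real^'n^'n"
  assumes sym: "transpose A = A"
  obtains l where "l \<in> eigenvalues A" "\<And>x. x \<bullet> (A *v x) \<le> l * (x \<bullet> x)"
proof -
  have "continuous_on (sphere 0 1) (\<lambda>x. x \<bullet> (A *v x))"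
    by (intro continuous_intros linear_continuous_on matrix_vector_mul_bounded_linear)
  moreover have "axis undefined 1 \<in> sphere (0::real^'n) 1"
    by simp
  ultimately obtain v where v: "norm v = 1"
    and max: "\<And>x. norm x = 1 \<Longrightarrow> x \<bullet> (A *v x) \<le> v \<bullet> (A *v v)"
    using continuous_attains_sup[of "sphere (0::real^'n) 1" "\<lambda>x. x \<bullet> (A *v x)"] by (auto simp: compact_sphere)
  define l where "l = v \<bullet> (A *v v)"
  have le: "x \<bullet> (A *v x) \<le> l * (x \<bullet> x)" for x
  proof (cases "x = 0")
    case False
    then have "(x /\<^sub>R norm x) \<bullet> (A *v (x /\<^sub>R norm x)) \<le> l"
      unfolding l_def by (intro max) simp
    then have "x \<bullet> (A *v x) / (norm x)\<^sup>2 \<le> l"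
      by (simp add: matrix_vector_mult_scaleR power2_eq_square divide_inverse_commute mult.assoc)
    then show ?thesis
      using False by (simp add: pos_divide_le_eq power2_norm_eq_inner)
  qed simp
  have *: "(l *\<^sub>R mat 1 - A) *v x = l *\<^sub>R x - A *v x" for x
    by (simp add: matrix_vector_mult_diff_rdistrib scaleR_matrix_vector_assoc[symmetric])
  have "(l *\<^sub>R mat 1 - A) *v v = 0"
  proof (rule psd_matrix_vector_eq_0)
    show "transpose (l *\<^sub>R mat 1 - A) = l *\<^sub>R mat 1 - A"
      using sym by (simp add: transpose_def mat_def vec_eq_iff)
    show "v \<bullet> ((l *\<^sub>R mat 1 - A) *v v) = 0"
      using v by (simp add: * inner_diff_right norm_eq_1) (simp add: l_def)
  qed (simp add: * inner_diff_right le)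
  then have "A *v v = l *\<^sub>R v" "v \<noteq> 0"
    using v by (auto simp: *)
  then have "l \<in> eigenvalues A"
    by (auto simp: eigenvalues_def)
  then show thesis using le by (rule that)
qed

section \<open>Projection onto the tangent cone\<close>

text \<open>The cone hull admits the factor \<open>0\<close>, the tangent cone only positive ones;
  they agree because \<open>y = x\<close> already contributes the zero vector. Convexity then
  follows from that of cone hulls.\<close>

lemma tangent_cone_eq_closure_cone_hull:
  assumes "x \<in> X"
  shows "tangent_cone X x = closure (cone hull ((\<lambda>y. y - x) ` X))"
proof -
  have "(\<Union>y\<in>X. \<Union>l\<in>{0<..}. {l *\<^sub>R (y - x)}) = {c *\<^sub>R z | c z. 0 \<le> c \<and> z \<in> (\<lambda>y. y - x) ` X}"
    (is "?L = ?R")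
  proof
    show "?R \<subseteq> ?L"
    proof clarify
      fix c :: real and y assume "0 \<le> c" "y \<in> X"
      then show "c *\<^sub>R (y - x) \<in> ?L"
      proof (cases "c = 0")
        case True
        then show ?thesis
          using assms by (intro UN_I[of x] UN_I[of 1]) auto
      next
        case False
        then show ?thesis
          using \<open>0 \<le> c\<close> \<open>y \<in> X\<close> by (intro UN_I[of y] UN_I[of c]) auto
      qed
    qed
  qed (force intro: less_imp_le)
  then show ?thesis
    by (simp add: tangent_cone_def cone_hull_expl)
qed

lemma convex_tangent_cone:
  assumes "convex X" "x \<in> X"
  shows "convex (tangent_cone X x)"
  unfolding tangent_cone_eq_closure_cone_hull[OF assms(2)]
  using assms(1) convex_translation_subtract[of X x]
  by (intro convex_closure convex_cone_hull) (simp add: image_def)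

text \<open>
  The residual of the projection lies in the normal cone: every positive multiple of \<open>y - x\<close> is
  a tangent vector, so the obtuse angle property can be divided by an arbitrarily large factor.
\<close>
lemma proj_tangent_residual:
  assumes X: "convex X" and x: "x \<in> X" and y: "y \<in> X"
  shows "(z - proj_tangent X x z) \<bullet> (y - x) \<le> 0"
proof -
  define p where "p = proj_tangent X x z"
  have obtuse: "k * ((z - p) \<bullet> (y - x)) \<le> (z - p) \<bullet> p" if "k > 0" for k
  proof -
    have "k *\<^sub>R (y - x) \<in> tangent_cone X x"
      unfolding tangent_cone_def using y that by (intro closure_subset[THEN subsetD]) auto
    then have "(z - p) \<bullet> (k *\<^sub>R (y - x) - p) \<le> 0"
      unfolding p_def proj_tangent_def
      by (intro closest_point_dot convex_tangent_cone X x) (auto simp: tangent_cone_def)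
    then show ?thesis
      by (simp add: inner_diff_right)
  qed
  have "(z - p) \<bullet> (y - x) \<le> 0"
  proof (rule ccontr)
    assume "\<not> ?thesis"
    then have pos: "(z - p) \<bullet> (y - x) > 0" by simp
    \<comment> \<open>With this factor the left side of \<open>obtuse\<close> is the absolute value
      of its right side plus one.\<close>
    define k where "k = (\<bar>(z - p) \<bullet> p\<bar> + 1) / ((z - p) \<bullet> (y - x))"
    have "k > 0" "k * ((z - p) \<bullet> (y - x)) = \<bar>(z - p) \<bullet> p\<bar> + 1"
      using pos by (auto simp: k_def)
    with obtuse[of k] show False by linarith
  qed
  then show ?thesis by (simp add: p_def)
qed

section \<open>Convergence of the pseudo-gradient dynamics\<close>

text \<open>
  Only the symmetric part of \<open>I - aP\<close> enters the quadratic form, so the eigenvalue bound gives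
  strong monotonicity of \<open>F\<close> with modulus \<open>1/2\<close>.
\<close>
lemma F_map_strongly_monotone:
  fixes P :: "real^'n^'n"
  assumes a: "a \<noteq> 0" and eig: "Max ((\<lambda>l. a * l) ` eigenvalues (P + transpose P)) < 1"
  shows "(x - y) \<bullet> (x - y) \<le> 2 * ((x - y) \<bullet> (F_map P a b x - F_map P a b y))"
proof -
  define Q where "Q = P + transpose P"
  define d where "d = x - y"
  have sym: "transpose Q = Q"
    by (simp add: Q_def transpose_def vec_eq_iff)
  have scale: "(a *\<^sub>R Q) *v v = a *\<^sub>R (Q *v v)" for v
    by (simp add: scaleR_matrix_vector_assoc)
  have "transpose (a *\<^sub>R Q) = a *\<^sub>R Q"
    using sym by (simp add: transpose_def vec_eq_iff)
  \<comment> \<open>Working with \<open>a *\<^sub>R Q\<close> instead of \<open>Q\<close> avoids a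
    case distinction on the sign of \<open>a\<close>; dividing by \<open>a\<close> afterwards
    returns to an eigenvalue of \<open>Q\<close>.\<close>
  from symmetric_matrix_rayleigh[OF this] obtain l where l: "l \<in> eigenvalues (a *\<^sub>R Q)"
    and le: "\<And>v. v \<bullet> ((a *\<^sub>R Q) *v v) \<le> l * (v \<bullet> v)"
    by metis
  from l obtain v where "v \<noteq> 0" and v: "a *\<^sub>R (Q *v v) = l *\<^sub>R v"
    by (auto simp: eigenvalues_def scale)
  have "Q *v v = (l / a) *\<^sub>R v"
    using arg_cong[OF v, of "\<lambda>w. (1 / a) *\<^sub>R w"] a by simp
  then have "l / a \<in> eigenvalues Q"
    using \<open>v \<noteq> 0\<close> by (auto simp: eigenvalues_def)
  then have "l \<in> (\<lambda>l. a * l) ` eigenvalues Q"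
    using a by (intro image_eqI[of _ _ "l / a"]) auto
  then have "l < 1"
    using eig Max_ge[OF finite_imageI[OF finite_eigenvalues[OF sym]], of l "\<lambda>l. a * l"]
    by (simp add: Q_def)
  have "a * (d \<bullet> (Q *v d)) \<le> l * (d \<bullet> d)"
    using le[of d] by (simp add: scale)
  also have "\<dots> \<le> d \<bullet> d"
    using mult_right_mono[of l 1 "d \<bullet> d"] \<open>l < 1\<close> by simp
  finally have "a * (d \<bullet> (Q *v d)) \<le> d \<bullet> d" .
  \<comment> \<open>Hence \<open>a * (d \<bullet> (P *v d))\<close> is at most half of
    \<open>d \<bullet> d\<close>, which is where the modulus one half comes from.\<close>
  moreover have "d \<bullet> (transpose P *v d) = d \<bullet> (P *v d)"
    using dot_lmul_matrix[of d P d] by (simp add: inner_commute)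
  then have "d \<bullet> (Q *v d) = 2 * (d \<bullet> (P *v d))"
    by (simp add: Q_def matrix_vector_mult_add_rdistrib inner_add_right)
  moreover have "F_map P a b x - F_map P a b y = d - a *\<^sub>R (P *v d)"
    by (simp add: F_map_def d_def matrix_vector_mult_diff_rdistrib matrix_vector_mult_diff_distrib
        scaleR_matrix_vector_assoc[symmetric] algebra_simps)
  ultimately show ?thesis
    by (simp add: d_def[symmetric] inner_diff_right)
qed

text \<open>Monotonicity is required only relative to the equilibrium \<open>xb\<close>. Modulus one
  half for \<open>G\<close> gives rate one for the squared distance.\<close>

lemma projected_dynamics_exponential_decay:
  assumes X: "convex X" and xb: "xb \<in> SOL X G"
    and mono: "\<And>y. y \<in> X \<Longrightarrow> (y - xb) \<bullet> (y - xb) \<le> 2 * ((y - xb) \<bullet> (G y - G xb))"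
    and sol: "caratheodory_solution X (\<lambda>t y. proj_tangent X y (- G y)) x"
    and T: "0 \<le> T"
  shows "(norm (x T - xb))\<^sup>2 \<le> exp (- T) * (norm (x 0 - xb))\<^sup>2"
proof -
  define W where "W t = exp t * ((x t - xb) \<bullet> (x t - xb))" for t
  have xbX: "xb \<in> X" and vi: "\<And>y. y \<in> X \<Longrightarrow> 0 \<le> (y - xb) \<bullet> G xb"
    using xb by (auto simp: SOL_def)
  have inX: "x t \<in> X" if "t \<ge> 0" for t
    using sol that by (simp add: caratheodory_solution_def)
  have "AE t in lebesgue. t \<ge> 0 \<longrightarrow>
      (x has_vector_derivative proj_tangent X (x t) (- G (x t))) (at t within {0..})"
    using sol by (simp add: caratheodory_solution_def)
  then obtain N where N: "N \<in> null_sets lebesgue" and deriv: "\<And>t. t \<notin> N \<Longrightarrow> t \<ge> 0 \<Longrightarrow>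
      (x has_vector_derivative proj_tangent X (x t) (- G (x t))) (at t within {0..})"
    unfolding eventually_ae_filter by fastforce
  have dissip: "2 * ((y - xb) \<bullet> proj_tangent X y (- G y)) \<le> - ((y - xb) \<bullet> (y - xb))" if "y \<in> X" for y
  proof -
    \<comment> \<open>Testing the residual against the direction to \<open>xb\<close> replaces the
      projected velocity by \<open>- G y\<close>; then \<open>mono\<close> compares
      \<open>G y\<close> with \<open>G xb\<close>, and \<open>vi\<close> disposes of the term with
      \<open>G xb\<close>.\<close>
    have "(- G y - proj_tangent X y (- G y)) \<bullet> (xb - y) \<le> 0"
      by (rule proj_tangent_residual[OF X that xbX])
    with mono[OF that] vi[OF that] show ?thesis
      by (simp add: inner_diff_left inner_diff_right inner_commute algebra_simps)
  qed
  have ac_x: "absolutely_continuous_on {0..T} x"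
    using sol T by (simp add: caratheodory_solution_def)
  have ac_diff: "absolutely_continuous_on {0..T} (\<lambda>t. x t - xb)"
    by (rule absolutely_continuous_on_dominated[OF ac_x ac_x, of _ 1]) simp
  \<comment> \<open>On \<open>{0..T}\<close> the derivative of \<open>exp\<close> is largest at
    \<open>T\<close>.\<close>
  have "(exp T)-lipschitz_on {0..T} (exp :: real \<Rightarrow> real)"
  proof (rule bounded_derivative_imp_lipschitz)
    show "(exp has_derivative (*) (exp t)) (at t within {0..T})" for t :: real
      using has_field_derivative_at_within[OF DERIV_exp] by (simp add: has_field_derivative_def)
    show "onorm ((*) (exp t)) \<le> exp T" if "t \<in> {0..T}" for t :: real
      using that by (intro onorm_bound) (auto simp: abs_mult mult_right_mono)
  qed auto
  then have "absolutely_continuous_on {0..T} (exp :: real \<Rightarrow> real)"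
    by (rule lipschitz_imp_absolutely_continuous_on)
  then have ac_W: "absolutely_continuous_on {0..T} W"
    unfolding W_def
    by (rule bounded_bilinear.absolutely_continuous_on[OF bounded_bilinear_mult _
        bounded_bilinear.absolutely_continuous_on[OF bounded_bilinear_inner ac_diff ac_diff]])
  have "W T \<le> W 0"
  proof (rule absolutely_continuous_on_deriv_nonpos[OF ac_W T N])
    fix t assume t: "t \<in> {0..T} - N"
    define p where "p = proj_tangent X (x t) (- G (x t))"
    have "(x has_vector_derivative p) (at t within {0..T})"
      using deriv[of t] t by (auto simp: p_def intro: has_vector_derivative_within_subset)
    then have "((\<lambda>t. x t - xb) has_derivative (\<lambda>h. h *\<^sub>R p)) (at t within {0..T})"
      by (auto simp: has_vector_derivative_def intro!: derivative_eq_intros)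
    from has_derivative_inner[OF this this]
    have "((\<lambda>t. (x t - xb) \<bullet> (x t - xb)) has_real_derivative 2 * ((x t - xb) \<bullet> p)) (at t within {0..T})"
      unfolding has_field_derivative_def
      by (rule has_derivative_eq_rhs) (auto simp: fun_eq_iff inner_commute algebra_simps)
    from DERIV_mult[OF has_field_derivative_at_within[OF DERIV_exp] this]
    have "(W has_real_derivative exp t * ((x t - xb) \<bullet> (x t - xb) + 2 * ((x t - xb) \<bullet> p)))
        (at t within {0..T})"
      unfolding W_def by (rule DERIV_cong) (simp add: algebra_simps)
    moreover have "exp t * ((x t - xb) \<bullet> (x t - xb) + 2 * ((x t - xb) \<bullet> p)) \<le> 0"
      using dissip[OF inX[of t]] t by (simp add: p_def mult_le_0_iff)
    ultimately show "\<exists>D\<le>0. (W has_real_derivative D) (at t within {0..T})"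
      by blast
  qed
  then show ?thesis
    by (simp add: W_def power2_norm_eq_inner exp_minus field_simps)
qed

theorem mainTheorem2:
  fixes P :: "real^'n^'n"
    and a :: real
    and b :: "real^'n"
    and Xc :: "'n \<Rightarrow> real set"
    and X U :: "(real^'n) set"
    and x_opt u_opt :: "real^'n"
  assumes P_range: "\<And>i j. 0 \<le> P $ i $ j \<and> P $ i $ j \<le> 1"
    and P_diag: "\<And>i. P $ i $ i = 0"
    and a_nz: "a \<noteq> 0"
    and X_prod: "X = {x. \<forall>i. x $ i \<in> Xc i}"
    and Xc: "\<And>i. Xc i \<noteq> {} \<and> closed (Xc i) \<and> convex (Xc i)"
    and U: "U \<noteq> {}" "closed U" "convex U" "0 \<in> U"
    and eig: "Max ((\<lambda>l. a * l) ` eigenvalues (P + transpose P)) < 1"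
    and x_opt: "x_opt = social_optimum P a b X"
    and x_opt_achievable: "x_opt \<in> achievable_set P a b X U"
    and u_opt: "u_opt \<in> U" "SOL X (\<lambda>x. F_map P a b x - u_opt) = {x_opt}"
  shows "(\<forall>x0\<in>X. \<forall>x. pseudo_gradient_solution P a b X (\<lambda>t. u_opt) x \<and> x 0 = x0
            \<longrightarrow> (x \<longlongrightarrow> x_opt) at_top)
         \<and> (\<exists>v\<in>normal_cone X x_opt. u_opt = (mat 1 - a *\<^sub>R P) *v x_opt - b + v)"
proof -
  let ?G = "\<lambda>x. F_map P a b x - u_opt"
  have SOL: "x_opt \<in> SOL X ?G"
    unfolding u_opt(2) by (rule singletonI)
  have X: "convex X"
    unfolding X_prod
  proof (rule convexI, clarify)
    fix x y :: "real^'n" and u v :: real and i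
    assume "\<forall>i. x $ i \<in> Xc i" "\<forall>i. y $ i \<in> Xc i" "0 \<le> u" "0 \<le> v" "u + v = 1"
    then show "(u *\<^sub>R x + v *\<^sub>R y) $ i \<in> Xc i"
      using convexD[of "Xc i" "x $ i" "y $ i" u v] Xc by simp
  qed
  have conv: "(x \<longlongrightarrow> x_opt) at_top"
    if "pseudo_gradient_solution P a b X (\<lambda>t. u_opt) x" for x
  proof -
    \<comment> \<open>The constant input is absorbed into the map: \<open>- ?G y\<close> equals
      \<open>- F_map P a b y + u_opt\<close>.\<close>
    have sol: "caratheodory_solution X (\<lambda>t y. proj_tangent X y (- ?G y)) x"
      using that by (simp add: pseudo_gradient_solution_def)
    have "(norm (x t - x_opt))\<^sup>2 \<le> exp (- t) * (norm (x 0 - x_opt))\<^sup>2" if "t \<ge> 0" for t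
    proof (rule projected_dynamics_exponential_decay[OF X SOL _ sol that])
      \<comment> \<open>The shift by \<open>u_opt\<close> cancels in the difference, so the
        monotonicity of \<open>F_map\<close> carries over.\<close>
      show "(y - x_opt) \<bullet> (y - x_opt) \<le> 2 * ((y - x_opt) \<bullet> (?G y - ?G x_opt))" for y
        using F_map_strongly_monotone[OF a_nz eig, of y x_opt b] by simp
    qed
    then have "\<forall>\<^sub>F t in at_top. (norm (x t - x_opt))\<^sup>2 \<le> exp (- t) * (norm (x 0 - x_opt))\<^sup>2"
      by (rule eventually_mono[OF eventually_ge_at_top[of 0]])
    moreover have "((\<lambda>t. exp (- t) * (norm (x 0 - x_opt))\<^sup>2) \<longlongrightarrow> 0) at_top"
      by (rule tendsto_mult_left_zero[OF filterlim_compose[OF exp_at_bot filterlim_uminus_at_bot_at_top]])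
    ultimately have "((\<lambda>t. (norm (x t - x_opt))\<^sup>2) \<longlongrightarrow> 0) at_top"
      by (rule tendsto_sandwich[OF always_eventually[OF allI[OF zero_le_power2]] _ tendsto_const])
    from tendsto_real_sqrt[OF this] have "((\<lambda>t. norm (x t - x_opt)) \<longlongrightarrow> 0) at_top"
      by simp
    then show ?thesis
      by (rule Lim_null[THEN iffD2, OF tendsto_norm_zero_cancel])
  qed
  have vi: "0 \<le> (s - x_opt) \<bullet> (F_map P a b x_opt - u_opt)" if "s \<in> X" for s
    using SOL that by (simp add: SOL_def)
  have "\<exists>v\<in>normal_cone X x_opt. u_opt = (mat 1 - a *\<^sub>R P) *v x_opt - b + v"
  proof
    \<comment> \<open>Solving the asserted identity for \<open>v\<close> forces this witness; the
      variational inequality with reversed sign is membership in the normal cone.\<close>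
    show "u_opt - F_map P a b x_opt \<in> normal_cone X x_opt"
      unfolding normal_cone_def
    proof clarify
      fix s assume "s \<in> X"
      from vi[OF this] show "(u_opt - F_map P a b x_opt) \<bullet> (s - x_opt) \<le> 0"
        by (simp add: inner_diff_left inner_diff_right inner_commute)
    qed
    show "u_opt = (mat 1 - a *\<^sub>R P) *v x_opt - b + (u_opt - F_map P a b x_opt)"
      by (simp add: F_map_def)
  qed
  with conv show ?thesis by blast
qed

end
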